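(* The polynomials $\{\mathrm{BoNa}_n(u)\}_{n\ge 2}$, where $\mathrm{BoNa}_n(u)=\sum_{k=1}^n \mathrm{BoNa}(n,k)u^k$, have weakly interlacing roots. More precisely, each polynomial $\mathrm{BoNa}_n(u)$ has a root at $0$, and the nonzero roots of $\mathrm{BoNa}_{n-1}(u)$ strictly interlace the nonzero roots of $\mathrm{BoNa}_n(u)$.
   Context: A binary plane tree is a rooted plane tree on unlabeled vertices in which every non-leaf vertex has one or two children, and every child is a left child or a right child, even if it is the only child of its parent. A 0-1-tree is a binary plane tree in which every vertex that has two children is labeled 0 or 1 (no other vertex is labeled). A right edge is an edge connecting a vertex to its right child. For $n\ge 1$, the Boolean-Narayana number $\mathrm{BoNa}(n,k)$ is the number of 0-1-trees on $n$ vertices that have exactly $k-1$ right edges. "Weakly interlacing roots" has here the meaning given by the "More precisely" sentence: consecutive polynomials share the root $0$, and their nonzero roots strictly interlace. The nonzero roots of $\mathrm{BoNa}_{n-1}(u)$ strictly interlace those of $\mathrm{BoNa}_n(u)$ if all these roots are real and, listing the nonzero roots (with multiplicity) of $\mathrm{BoNa}_n$ as $x_1,\ldots,x_{n-1}$ and those of $\mathrm{BoNa}_{n-1}$ as $y_1,\ldots,y_{n-2}$ in increasing order, one has $x_1<y_1<x_2<y_2<\cdots<y_{n-2}<x_{n-1}$. *)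

theory Defs
  imports Complex_Main "HOL-Library.Multiset" "HOL-Computational_Algebra.Computational_Algebra"
begin

text \<open>Every constructor is a vertex, so there is no empty tree. Only vertices with two children
  carry a label, \<open>True\<close> standing for 1 and \<open>False\<close> for 0.\<close>

datatype tree01 =
    Leaf
  | Left_Only tree01
  | Right_Only tree01
  | Both bool tree01 tree01

fun vertices :: "tree01 \<Rightarrow> nat" where
  "vertices Leaf = 1"
| "vertices (Left_Only l) = 1 + vertices l"
| "vertices (Right_Only r) = 1 + vertices r"
| "vertices (Both b l r) = 1 + vertices l + vertices r"

fun right_edges :: "tree01 \<Rightarrow> nat" where
  "right_edges Leaf = 0"
| "right_edges (Left_Only l) = right_edges l"
| "right_edges (Right_Only r) = 1 + right_edges r"
| "right_edges (Both b l r) = 1 + right_edges l + right_edges r"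

text \<open>Stating \<open>k - 1\<close> right edges additively avoids truncated subtraction at \<open>k = 0\<close>.\<close>

definition BoNa :: "nat \<Rightarrow> nat \<Rightarrow> nat" where
  "BoNa n k = card {t. vertices t = n \<and> right_edges t + 1 = k}"

text \<open>The counted sets are finite, so \<open>card\<close> is the true number of trees.\<close>

lemma vertices_pos: "0 < vertices t"
  by (cases t) auto

lemma finite_vertices_le: "finite {t. vertices t \<le> n}"
proof (induction n)
  case 0
  have "{t. vertices t \<le> 0} = {}"
    using vertices_pos by (auto simp: not_le)
  then show ?case by (simp only: finite.emptyI)
next
  case (Suc n)
  let ?A = "{t. vertices t \<le> n}"
  have "{t. vertices t \<le> Suc n} \<subseteq> {Leaf} \<union> Left_Only ` ?A \<union> Right_Only ` ?A
      \<union> (\<lambda>(b, l, r). Both b l r) ` (UNIV \<times> ?A \<times> ?A)"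
  proof
    fix t assume "t \<in> {t. vertices t \<le> Suc n}"
    then show "t \<in> {Leaf} \<union> Left_Only ` ?A \<union> Right_Only ` ?A
      \<union> (\<lambda>(b, l, r). Both b l r) ` (UNIV \<times> ?A \<times> ?A)"
      by (cases t) (force simp: image_iff)+
  qed
  moreover have "finite \<dots>"
    using Suc by (intro finite_UnI finite_imageI finite_cartesian_product) auto
  ultimately show ?case by (rule finite_subset)
qed

lemma finite_BoNa_set: "finite {t. vertices t = n \<and> right_edges t + 1 = k}"
  by (rule finite_subset[OF _ finite_vertices_le[of n]]) auto

definition BoNa_poly :: "nat \<Rightarrow> real poly" where
  "BoNa_poly n = (\<Sum>k = 1..n. monom (of_nat (BoNa n k)) k)"

definition real_rooted :: "real poly \<Rightarrow> bool" where
  "real_rooted p \<longleftrightarrow> (\<forall>z::complex. poly (map_poly complex_of_real p) z = 0 \<longrightarrow> z \<in> \<real>)"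

text \<open>The nonzero real roots, repeated according to multiplicity, in increasing order. For a
  real-rooted polynomial these are all its nonzero complex roots.\<close>

definition nonzero_roots :: "real poly \<Rightarrow> real list" where
  "nonzero_roots p = sorted_list_of_multiset (filter_mset (\<lambda>x. x \<noteq> 0) (proots p))"

text \<open>\<open>strictly_interlaces q p\<close>: the nonzero roots \<open>ys\<close> of \<open>q\<close> lie strictly between consecutive
  nonzero roots \<open>xs\<close> of \<open>p\<close>, i.e. \<open>xs ! 0 < ys ! 0 < xs ! 1 < ys ! 1 < \<dots>\<close>.\<close>

definition strictly_interlaces :: "real poly \<Rightarrow> real poly \<Rightarrow> bool" where
  "strictly_interlaces q p \<longleftrightarrow>
     real_rooted p \<and> real_rooted q \<and>
     (let xs = nonzero_roots p; ys = nonzero_roots q in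
        length xs = length ys + 1 \<and>
        (\<forall>i < length ys. xs ! i < ys ! i \<and> ys ! i < xs ! (i + 1)))"

end

theory Submission
  imports Defs
begin

text \<open>Let \<open>P\<^sub>n = BoNa\<^sub>n / u\<close> be the generating polynomial of 0-1-trees by right edges. Removing the
  root gives \<open>T = X (1 + (1 + u) T + 2 u T\<^sup>2)\<close> for \<open>T = \<Sum> P\<^sub>n X\<^sup>n\<close>, and since \<open>T\<close> is quadratic over
  the rational functions,
  \<open>(n + 1) P\<^sub>n = (2 n - 1) (1 + u) P\<^bsub>n - 1\<^esub> - (n - 2) (1 - 6 u + u\<^sup>2) P\<^bsub>n - 2\<^esub>\<close>.
  Since \<open>1 - 6 u + u\<^sup>2 > 0\<close> for \<open>u < 0\<close>, the values of \<open>P\<^sub>n\<close> and \<open>P\<^bsub>n - 2\<^esub>\<close> at the (negative) roots of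
  \<open>P\<^bsub>n - 1\<^esub>\<close> have opposite signs. As \<open>P\<^sub>n\<close> is monic of degree \<open>n - 1\<close> with \<open>P\<^sub>n(0) = 1\<close>, the
  intermediate value theorem inductively yields \<open>n - 1\<close> negative roots interlaced by those of
  \<open>P\<^bsub>n - 1\<^esub>\<close>.\<close>


section \<open>The generating polynomial by right edges\<close>

text \<open>Summing over trees rather than over values of \<open>right_edges\<close> turns root
  removal into a partition of the index set.\<close>

definition right_edge_poly :: "nat \<Rightarrow> real poly" where
  "right_edge_poly n = (\<Sum>t | vertices t = n. monom 1 (right_edges t))"

lemma finite_vertices_eq: "finite {t. vertices t = n}"
  by (rule finite_subset[OF _ finite_vertices_le[of n]]) auto

lemma right_edges_less_vertices: "right_edges t < vertices t"
  by (induction t) auto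

lemma right_edge_poly_0 [simp]: "right_edge_poly 0 = 0"
proof -
  have "{t. vertices t = 0} = {}"
    using vertices_pos by auto
  then show ?thesis
    unfolding right_edge_poly_def by (simp only: sum.empty)
qed

lemma right_edge_poly_1 [simp]: "right_edge_poly (Suc 0) = 1"
proof -
  have "vertices t = 1 \<longleftrightarrow> t = Leaf" for t
  proof (cases t)
    case (Both b l r)
    then show ?thesis using vertices_pos[of l] vertices_pos[of r] by simp
  qed (use vertices_pos in auto)
  then have "{t. vertices t = Suc 0} = {Leaf}"
    by auto
  then show ?thesis
    unfolding right_edge_poly_def by simp
qed

lemma coeff_right_edge_poly:
  "coeff (right_edge_poly n) k = real (card {t. vertices t = n \<and> right_edges t = k})"
proof -
  have "coeff (right_edge_poly n) k = (\<Sum>t | vertices t = n. if right_edges t = k then 1 else 0)"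
    by (simp add: right_edge_poly_def coeff_sum)
  also have "\<dots> = (\<Sum>t\<in>{t. vertices t = n} \<inter> {t. right_edges t = k}. 1)"
    by (subst sum.inter_restrict[OF finite_vertices_eq]) (simp add: if_distrib)
  also have "{t. vertices t = n} \<inter> {t. right_edges t = k} = {t. vertices t = n \<and> right_edges t = k}"
    by auto
  finally show ?thesis by simp
qed

text \<open>The factor \<open>u\<close> absorbs the shift from \<open>k - 1\<close> to
  \<open>k\<close>; cutting the sum at \<open>n\<close> loses nothing because a tree has fewer right
  edges than vertices.\<close>

lemma BoNa_poly_eq: "BoNa_poly n = [:0, 1:] * right_edge_poly n"
proof (rule poly_eqI)
  fix k
  have *: "coeff (BoNa_poly n) k = (if k \<in> {1..n} then real (BoNa n k) else 0)" for k
    by (simp add: BoNa_poly_def coeff_sum)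
  show "coeff (BoNa_poly n) k = coeff ([:0, 1:] * right_edge_poly n) k"
  proof (cases k)
    case 0
    then show ?thesis by (simp add: *)
  next
    case (Suc j)
    have "BoNa n (Suc j) = 0" if "j \<ge> n"
    proof -
      have "{t. vertices t = n \<and> right_edges t + 1 = Suc j} = {}"
        using that right_edges_less_vertices by (auto simp: not_less[symmetric])
      then show ?thesis unfolding BoNa_def by (simp only: card.empty)
    qed
    then show ?thesis
      using Suc by (auto simp: * coeff_right_edge_poly BoNa_def)
  qed
qed

section \<open>Decomposition at the root\<close>

text \<open>In \<open>[:0, 2:]\<close>, the 2 counts the labels of the root and \<open>u\<close> its
  right edge. The end terms of the convolution vanish, as there is no empty tree.\<close>

lemma sum_Both:
  "(\<Sum>t\<in>(\<lambda>(b, l, r). Both b l r) ` (UNIV \<times> {(l, r). vertices l + vertices r = n}).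
      monom 1 (right_edges t))
    = [:0, 2:] * (\<Sum>i\<le>n. right_edge_poly i * right_edge_poly (n - i))"
proof -
  let ?S = "{(l, r). vertices l + vertices r = n}"
  let ?f = "\<lambda>(l, r). monom 1 (right_edges l) * monom 1 (right_edges r) :: real poly"
  have S: "?S = (\<Union>i\<le>n. {t. vertices t = i} \<times> {t. vertices t = n - i})"
    by auto
  have "sum ?f ?S = (\<Sum>i\<le>n. sum ?f ({t. vertices t = i} \<times> {t. vertices t = n - i}))"
    unfolding S by (rule sum.UNION_disjoint) (auto intro!: finite_vertices_eq)
  also have "\<dots> = (\<Sum>i\<le>n. right_edge_poly i * right_edge_poly (n - i))"
    unfolding right_edge_poly_def sum_product sum.cartesian_product ..
  finally have f: "sum ?f ?S = (\<Sum>i\<le>n. right_edge_poly i * right_edge_poly (n - i))" .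
  have inj: "inj_on (\<lambda>(b, l, r). Both b l r) (UNIV \<times> ?S)"
    by (auto simp: inj_on_def)
  have "(\<Sum>t\<in>(\<lambda>(b, l, r). Both b l r) ` (UNIV \<times> ?S). monom 1 (right_edges t))
      = (\<Sum>(b :: bool, lr)\<in>UNIV \<times> ?S. [:0, 1:] * ?f lr)"
    unfolding sum.reindex[OF inj]
    by (rule sum.cong) (auto simp: mult_monom monom_Suc)
  also have "\<dots> = (\<Sum>b::bool\<in>UNIV. \<Sum>lr\<in>?S. [:0, 1:] * ?f lr)"
    by (simp only: sum.cartesian_product)
  also have "\<dots> = (\<Sum>b::bool\<in>UNIV. [:0, 1:] * sum ?f ?S)"
    by (simp only: sum_distrib_left)
  also have "\<dots> = [:0, 2:] * sum ?f ?S"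
    by (simp add: UNIV_bool numeral_poly)
  finally show ?thesis unfolding f .
qed

lemma right_edge_poly_Suc:
  assumes "n \<ge> 1"
  shows "right_edge_poly (Suc n) = [:1, 1:] * right_edge_poly n
    + [:0, 2:] * (\<Sum>i\<le>n. right_edge_poly i * right_edge_poly (n - i))"
proof -
  let ?A = "{t. vertices t = n}"
  let ?B = "(\<lambda>(b, l, r). Both b l r) ` (UNIV \<times> {(l, r). vertices l + vertices r = n})"
  have eq: "{t. vertices t = Suc n} = Left_Only ` ?A \<union> (Right_Only ` ?A \<union> ?B)"
  proof (rule set_eqI)
    fix t
    show "t \<in> {t. vertices t = Suc n} \<longleftrightarrow> t \<in> Left_Only ` ?A \<union> (Right_Only ` ?A \<union> ?B)"
      \<comment> \<open>\<open>n \<ge> 1\<close> rules out \<open>Leaf\<close>.\<close>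
      using assms by (cases t) (auto simp: image_iff)
  qed
  have fin: "finite (Left_Only ` ?A)" "finite (Right_Only ` ?A)" "finite ?B"
    using finite_vertices_eq[of "Suc n"] unfolding eq by simp_all
  have disj: "Left_Only ` ?A \<inter> (Right_Only ` ?A \<union> ?B) = {}" "Right_Only ` ?A \<inter> ?B = {}"
    by auto
  have "right_edge_poly (Suc n) = (\<Sum>t\<in>Left_Only ` ?A. monom 1 (right_edges t))
      + ((\<Sum>t\<in>Right_Only ` ?A. monom 1 (right_edges t)) + (\<Sum>t\<in>?B. monom 1 (right_edges t)))"
    unfolding right_edge_poly_def eq
    by (simp only: sum.union_disjoint[OF fin(1) finite_UnI[OF fin(2,3)] disj(1)]
        sum.union_disjoint[OF fin(2,3) disj(2)])
  also have "(\<Sum>t\<in>Left_Only ` ?A. monom 1 (right_edges t)) = right_edge_poly n"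
    by (simp add: sum.reindex inj_on_def right_edge_poly_def)
  also have "(\<Sum>t\<in>Right_Only ` ?A. monom 1 (right_edges t)) = [:0, 1:] * right_edge_poly n"
    by (simp add: sum.reindex inj_on_def right_edge_poly_def sum_distrib_left monom_Suc)
  finally show ?thesis unfolding sum_Both by (simp add: algebra_simps)
qed

section \<open>The three-term recurrence\<close>

text \<open>The coefficient sequence of a power series \<open>T = X (1 + a T + b T\<^sup>2)\<close> satisfies a three-term
  recurrence because \<open>S = 1 - a X - 2 b X T\<close> is a square root of the quadratic
  \<open>D = 1 - 2 a X + (a\<^sup>2 - 4 b) X\<^sup>2\<close>, so that \<open>2 D S' = D' S\<close>.\<close>

lemma fps_quadratic_recurrence:
  fixes T :: "'a :: {idom, semiring_char_0} fps"
  assumes T: "T = fps_X * (1 + fps_const a * T + fps_const b * T\<^sup>2)" and "b \<noteq> 0"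
  shows "of_nat (n + 4) * fps_nth T (n + 3)
    = of_nat (2 * n + 5) * a * fps_nth T (n + 2) - of_nat (n + 1) * (a\<^sup>2 - 4 * b) * fps_nth T (n + 1)"
proof -
  let ?X = "fps_X :: 'a fps"
  let ?a = "fps_const a" and ?b = "fps_const b"
  define c where "c = a\<^sup>2 - 4 * b"
  have c: "fps_const c = ?a\<^sup>2 - 4 * ?b"
    by (simp add: c_def power2_eq_square numeral_fps_const)
  define S where "S = 1 - ?a * ?X - 2 * ?b * ?X * T"
  define D where "D = 1 - 2 * ?a * ?X + fps_const c * ?X\<^sup>2"
  have "S\<^sup>2 = (1 - ?a * ?X)\<^sup>2 - 4 * ?b * ?X * (T - ?X * (?a * T + ?b * T\<^sup>2))"
    unfolding S_def by (simp add: power2_eq_square algebra_simps)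
  also have "T - ?X * (?a * T + ?b * T\<^sup>2) = ?X"
    using T by (simp add: algebra_simps)
  finally have SD: "S\<^sup>2 = D"
    unfolding D_def c by (simp add: power2_eq_square algebra_simps)
  \<comment> \<open>With the extra factor \<open>S\<close>, both sides become
    \<open>2 S^3 S'\<close> once \<open>D\<close> is replaced by \<open>S^2\<close>; the factor then
    cancels, since its constant coefficient is 1.\<close>
  have "S * (2 * D * fps_deriv S) = S * (fps_deriv D * S)"
    unfolding SD[symmetric] by (simp add: power2_eq_square algebra_simps)
  moreover have "fps_nth S 0 = 1"
    by (simp add: S_def fps_mult_nth_0)
  then have "S \<noteq> 0" by auto
  ultimately have ode: "2 * D * fps_deriv S = fps_deriv D * S"
    by simp
  have D': "fps_deriv D = 2 * fps_const c * ?X - 2 * ?a"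
    by (simp add: D_def power2_eq_square algebra_simps)
  \<comment> \<open>Every product is nested with constants and \<open>fps_X\<close> on the left, so
    that coefficients can be read off by rewriting.\<close>
  have "2 * (fps_deriv S - (?a * (?X * fps_deriv S) + ?a * (?X * fps_deriv S)) + fps_const c * (?X * (?X * fps_deriv S)))
      = 2 * (fps_const c * (?X * S) - ?a * S)" (is "2 * ?L = 2 * ?R")
    using ode unfolding D' by (simp add: D_def power2_eq_square algebra_simps)
  moreover have "(2 :: 'a fps) \<noteq> 0"
    by (simp add: numeral_fps_const)
  ultimately have ode': "?L = ?R"
    by (simp only: mult_cancel_left) simp
  \<comment> \<open>From index 2 on, \<open>1 - a X\<close> no longer contributes to
    \<open>S\<close>.\<close>
  have S_nth: "fps_nth S (Suc (Suc k)) = - 2 * b * fps_nth T (Suc k)" for k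
    by (simp add: S_def mult.assoc fps_numeral_fps_const numeral_fps_const)
  \<comment> \<open>This coefficient involves \<open>S\<close> only at indices \<open>n + 2\<close>
    to \<open>n + 4\<close>, all within reach of \<open>S_nth\<close>.\<close>
  have "fps_nth ?L (n + 3) = fps_nth ?R (n + 3)"
    by (simp only: ode')
  then have "(2 * b) * (of_nat (n + 4) * fps_nth T (n + 3)) =
     (2 * b) * (of_nat (2 * n + 5) * a * fps_nth T (n + 2) - of_nat (n + 1) * c * fps_nth T (n + 1))"
    unfolding fps_sub_nth fps_add_nth fps_mult_left_const_nth fps_X_mult_nth fps_deriv_nth
    by (simp add: S_nth numeral_eq_Suc algebra_simps)
  then show ?thesis using \<open>b \<noteq> 0\<close> unfolding c_def by simp
qed

text \<open>The quadratic equation has \<open>a = 1 + u\<close> and \<open>b = 2 u\<close>, whence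
  \<open>a^2 - 4 b = 1 - 6 u + u^2\<close>.\<close>

lemma right_edge_poly_recurrence:
  "of_nat (n + 4) * right_edge_poly (n + 3) = of_nat (2 * n + 5) * [:1, 1:] * right_edge_poly (n + 2)
     - of_nat (n + 1) * [:1, -6, 1:] * right_edge_poly (n + 1)"
proof -
  define T where "T = Abs_fps right_edge_poly"
  have T: "fps_nth T n = right_edge_poly n" for n
    by (simp add: T_def)
  have "T = fps_X * (1 + fps_const [:1, 1:] * T + fps_const [:0, 2:] * T\<^sup>2)"
  proof (rule fps_ext)
    fix n
    show "fps_nth T n = fps_nth (fps_X * (1 + fps_const [:1, 1:] * T + fps_const [:0, 2:] * T\<^sup>2)) n"
    proof (cases n)
      case (Suc m)
      then show ?thesis
        \<comment> \<open>The coefficient of \<open>X\<close> is the leaf; all later ones are root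
          removal.\<close>
        by (cases m) (simp_all only: right_edge_poly_Suc T fps_X_mult_nth fps_add_nth
          fps_mult_left_const_nth fps_square_nth, simp_all add: T)
    qed (simp add: T)
  qed
  from fps_quadratic_recurrence[OF this, of n] show ?thesis
    unfolding T by (simp add: power2_eq_square numeral_poly)
qed


section \<open>Values, degree and leading coefficient\<close>

lemma poly_right_edge_poly_recurrence:
  "real (n + 4) * poly (right_edge_poly (n + 3)) u
    = real (2 * n + 5) * (1 + u) * poly (right_edge_poly (n + 2)) u
     - real (n + 1) * (1 - 6 * u + u\<^sup>2) * poly (right_edge_poly (n + 1)) u"
  using arg_cong[OF right_edge_poly_recurrence[of n], of "\<lambda>p. poly p u"]
  by (simp add: power2_eq_square algebra_simps)

lemma right_edge_poly_2: "right_edge_poly 2 = [:1, 1:]"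
  using right_edge_poly_Suc[of 1] by (simp add: numeral_2_eq_2)

lemma degree_right_edge_poly: "degree (right_edge_poly (Suc n)) \<le> n"
proof (rule degree_le, intro allI impI)
  fix k assume "n < k"
  moreover have "right_edges t \<le> n" if "vertices t = Suc n" for t
    using right_edges_less_vertices[of t] that by simp
  ultimately have "{t. vertices t = Suc n \<and> right_edges t = k} = {}"
    by fastforce
  then show "coeff (right_edge_poly (Suc n)) k = 0"
    unfolding coeff_right_edge_poly by (simp only: card.empty of_nat_0)
qed

text \<open>Comparing top coefficients in the recurrence gives
  \<open>(2 m + 5) - (m + 1) = m + 4\<close>, which cancels the factor on the left.\<close>

lemma coeff_right_edge_poly_top: "coeff (right_edge_poly (Suc n)) n = 1"
proof (induction n rule: less_induct)
  case (less n)
  consider "n = 0" | "n = 1" | m where "n = m + 2"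
    by (metis One_nat_def add_2_eq_Suc' not0_implies_Suc)
  then show ?case
  proof cases
    case 2
    then show ?thesis using right_edge_poly_2 by (simp add: numeral_2_eq_2)
  next
    case 3
    have z: "coeff (right_edge_poly (m + 2)) (Suc (Suc m)) = 0"
        "coeff (right_edge_poly (m + 1)) (Suc (Suc m)) = 0"
        "coeff (right_edge_poly (m + 1)) (Suc m) = 0"
      using degree_right_edge_poly[of "m + 1"] degree_right_edge_poly[of m]
      by (auto intro!: coeff_eq_0)
    have IH: "coeff (right_edge_poly (m + 2)) (Suc m) = 1" "coeff (right_edge_poly (m + 1)) m = 1"
      using less.IH[of "Suc m"] less.IH[of m] 3 by auto
    have "coeff (of_nat (m + 4) * right_edge_poly (m + 3)) (Suc (Suc m))
       = coeff (of_nat (2 * m + 5) * ([:1, 1:] * right_edge_poly (m + 2))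
     - of_nat (m + 1) * ([:1, -6, 1:] * right_edge_poly (m + 1))) (Suc (Suc m))"
      by (simp only: right_edge_poly_recurrence mult.assoc)
    then have "real (m + 4) * coeff (right_edge_poly (m + 3)) (Suc (Suc m))
        = real (2 * m + 5) * 1 - real (m + 1) * 1"
      unfolding of_nat_poly using z IH by (simp del: of_nat_add)
    then have "real (m + 4) * coeff (right_edge_poly (m + 3)) (Suc (Suc m)) = real (m + 4) * 1"
      by simp
    then have "coeff (right_edge_poly (m + 3)) (Suc (Suc m)) = 1"
      by (subst (asm) mult_left_cancel) auto
    then show ?thesis using 3 by (simp add: numeral_eq_Suc)
  qed auto
qed

lemma poly_right_edge_poly_0: "poly (right_edge_poly (Suc n)) 0 = 1"
proof (induction n)
  case (Suc n)
  show ?case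
    unfolding right_edge_poly_Suc[of "Suc n", simplified] using Suc by simp
qed simp

section \<open>Signs and roots of monic polynomials\<close>

text \<open>Agreement at \<open>m\<close> points and in the coefficient of degree \<open>m\<close>
  determines a polynomial of degree at most \<open>m\<close>.\<close>

lemma monic_poly_eq_prod:
  fixes p :: "'a :: idom poly"
  assumes "degree p \<le> m" "coeff p m = 1" "\<And>i. i < m \<Longrightarrow> poly p (z i) = 0" "inj_on z {..<m}"
  shows "p = (\<Prod>i<m. [:- z i, 1:])"
proof (rule poly_eqI_degree_lead_coeff[where A = "z ` {..<m}" and n = m])
  let ?q = "\<Prod>i<m. [:- z i, 1:]"
  have deg: "degree ?q = m"
    by (subst degree_prod_eq_sum_degree) auto
  then show "degree ?q \<le> m" by simp
  show "coeff p m = coeff ?q m"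
    using lead_coeff_prod[of "\<lambda>i. [:- z i, 1:]" "{..<m}"] assms(2) unfolding deg by simp
  show "m \<le> card (z ` {..<m})"
    using assms(4) by (simp add: card_image)
  show "poly p x = poly ?q x" if "x \<in> z ` {..<m}" for x
    using that assms(3) by (auto simp: poly_prod)
qed fact

text \<open>Exactly the \<open>m - j\<close> factors whose roots exceed \<open>a\<close> are
  negative.\<close>

lemma sgn_prod_linear:
  fixes a :: real
  assumes "j \<le> m" "\<And>i. i < j \<Longrightarrow> x i < a" "\<And>i. j \<le> i \<Longrightarrow> i < m \<Longrightarrow> a < x i"
  shows "sgn (poly (\<Prod>i<m. [:- x i, 1:]) a) = (- 1) ^ (m - j)"
proof -
  have "sgn (poly (\<Prod>i<m. [:- x i, 1:]) a) = (\<Prod>i<m. sgn (a - x i))"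
    unfolding poly_prod by (induction m) (simp_all add: sgn_mult)
  also have "\<dots> = (\<Prod>i<j. sgn (a - x i)) * (\<Prod>i=j..<m. sgn (a - x i))"
    using assms(1) by (metis prod.atLeastLessThan_concat atLeast0LessThan zero_le)
  also have "(\<Prod>i<j. sgn (a - x i)) = 1"
    using assms(2) by (intro prod.neutral) auto
  also have "(\<Prod>i=j..<m. sgn (a - x i)) = (\<Prod>i=j..<m. - 1)"
    using assms(3) by (intro prod.cong) auto
  finally show ?thesis by simp
qed

lemma monic_poly_sgn_at_bot:
  fixes p :: "real poly"
  assumes "degree p = m" "coeff p m = 1"
  shows "\<exists>b<c. sgn (poly p b) = (- 1) ^ m"
proof -
  \<comment> \<open>Reflection in the origin, normalised to be monic, moves the question to positive
    infinity.\<close>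
  let ?q = "smult ((- 1) ^ m) (pcompose p [:0, - 1:])"
  have "lead_coeff ?q = 1"
    using assms by (simp add: lead_coeff_comp flip: power_mult_distrib)
  then obtain N where N: "\<forall>x\<ge>N. poly ?q x \<ge> 1"
    using poly_pinfty_gt_lc[of ?q] by auto
  define b where "b = - max N (1 - c)"
  have "(- 1) ^ m * poly p b \<ge> 1"
    using N[rule_format, of "- b"] by (simp add: b_def poly_pcompose)
  then have "sgn (poly p b) = (- 1) ^ m"
    by (cases "even m") (auto simp: sgn_if)
  moreover have "b < c" by (simp add: b_def)
  ultimately show ?thesis by blast
qed

text \<open>The signs of \<open>r\<close> alternate along \<open>m + 2\<close> points, so each of
  the \<open>m + 1\<close> gaps contains a root; the degree leaves room for no more.\<close>

lemma interlacing_step: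
  fixes r :: "real poly" and x :: "nat \<Rightarrow> real"
  assumes r: "degree r = Suc m" "coeff r (Suc m) = 1" "poly r 0 > 0"
    and x: "strict_mono_on {..<m} x" "\<And>i. i < m \<Longrightarrow> x i < 0"
    and s: "\<And>i. i < m \<Longrightarrow> sgn (poly r (x i)) = (- 1) ^ (m - i)"
  shows "\<exists>z. r = (\<Prod>i<Suc m. [:- z i, 1:]) \<and> strict_mono_on {..<Suc m} z \<and> (\<forall>i<Suc m. z i < 0) \<and>
    (\<forall>i<m. z i < x i \<and> x i < z (Suc i))"
proof -
  obtain b where b: "b < (if m = 0 then 0 else x 0)" "sgn (poly r b) = (- 1) ^ Suc m"
    using monic_poly_sgn_at_bot[OF r(1,2)] by blast
  \<comment> \<open>The points are \<open>b\<close>, then the \<open>x i\<close>, then 0; the index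
    of \<open>x\<close> is therefore shifted by one.\<close>
  define p where "p j = (if j = 0 then b else if j = Suc m then 0 else x (j - 1))" for j
  have "\<exists>z. p j < z \<and> z < p (Suc j) \<and> poly r z = 0" if "j < Suc m" for j
  proof -
    have p_sgn: "sgn (poly r (p i)) = (- 1) ^ (Suc m - i)" if "i \<le> Suc m" for i
      using that b(2) r(3) s[of "i - 1"] by (auto simp: p_def)
    have "sgn (poly r (p j) * poly r (p (Suc j))) = (- 1) ^ (Suc m - j) * (- 1) ^ (m - j)"
      using that by (simp add: sgn_mult p_sgn)
    also have "\<dots> = - 1"
      using that by (simp add: Suc_diff_le flip: power_mult_distrib)
    finally have "poly r (p j) * poly r (p (Suc j)) < 0"
      by (simp only: sgn_1_neg)
    moreover have "p j < p (Suc j)"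
      using that b(1) x(2)[of "j - 1"] strict_mono_onD[OF x(1), of "j - 1" j]
      by (auto simp: p_def split: if_splits)
    ultimately show ?thesis using poly_IVT by blast
  qed
  then obtain z where z: "\<And>j. j < Suc m \<Longrightarrow> p j < z j \<and> z j < p (Suc j) \<and> poly r (z j) = 0"
    by metis
  have zx: "z i < x i" "x i < z (Suc i)" if "i < m" for i
    using z[of i] z[of "Suc i"] that by (auto simp: p_def)
  have mono: "strict_mono_on {..<Suc m} z"
  proof (rule strict_mono_onI)
    fix i j assume "i \<in> {..<Suc m}" "j \<in> {..<Suc m}" "i < j"
    then have "z i < x i" "x i \<le> x (j - 1)" "x (j - 1) < z j"
      using zx[of i] zx[of "j - 1"] strict_mono_on_leD[OF x(1), of i "j - 1"] by auto
    then show "z i < z j" by linarith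
  qed
  moreover have "r = (\<Prod>i<Suc m. [:- z i, 1:])"
    using r z strict_mono_on_imp_inj_on[OF mono] by (intro monic_poly_eq_prod) auto
  moreover have "z i < 0" if "i < Suc m" for i
    using z[OF that] x(2)[of i] that by (auto simp: p_def split: if_splits)
  ultimately show ?thesis using zx by blast
qed

section \<open>The interlacing induction\<close>

lemma right_edge_poly_interlacing:
  "\<exists>x y. right_edge_poly (n + 2) = (\<Prod>i<Suc n. [:- x i, 1:]) \<and>
    right_edge_poly (n + 1) = (\<Prod>i<n. [:- y i, 1:]) \<and>
    strict_mono_on {..<Suc n} x \<and> strict_mono_on {..<n} y \<and>
    (\<forall>i<Suc n. x i < 0) \<and> (\<forall>i<n. y i < 0) \<and> (\<forall>i<n. x i < y i \<and> y i < x (Suc i))"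
proof (induction n)
  case 0
  show ?case
    \<comment> \<open>The only root of \<open>1 + u\<close>; the family \<open>y\<close> is empty
      here.\<close>
    by (rule exI[of _ "\<lambda>_. - 1"])
      (auto simp: right_edge_poly_2 [unfolded numeral_2_eq_2] numeral_2_eq_2 intro: strict_mono_onI)
next
  case (Suc n)
  then obtain x y where p: "right_edge_poly (n + 2) = (\<Prod>i<Suc n. [:- x i, 1:])"
    and q: "right_edge_poly (n + 1) = (\<Prod>i<n. [:- y i, 1:])"
    and x: "strict_mono_on {..<Suc n} x" "\<forall>i<Suc n. x i < 0"
    and y: "strict_mono_on {..<n} y"
    and xy: "\<forall>i<n. x i < y i \<and> y i < x (Suc i)"
    by blast
  let ?r = "right_edge_poly (n + 3)"
  have r: "degree ?r = Suc (Suc n)" "coeff ?r (Suc (Suc n)) = 1" "poly ?r 0 > 0"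
    using degree_right_edge_poly[of "n + 2"] coeff_right_edge_poly_top[of "n + 2"]
      poly_right_edge_poly_0[of "n + 2"] le_degree[of ?r "n + 2"]
    by (auto simp: numeral_eq_Suc)
  have "sgn (poly ?r (x i)) = (- 1) ^ (Suc n - i)" if i: "i < Suc n" for i
  proof -
    \<comment> \<open>By interlacing, exactly \<open>i\<close> of the \<open>y k\<close> lie below
      \<open>x i\<close>.\<close>
    have "sgn (poly (right_edge_poly (n + 1)) (x i)) = (- 1) ^ (n - i)"
      unfolding q
    proof (rule sgn_prod_linear)
      fix k assume "k < i"
      then have "y k < x (Suc k)" "x (Suc k) \<le> x i"
        using xy i strict_mono_on_leD[OF x(1), of "Suc k" i] by auto
      then show "y k < x i" by linarith
    next
      fix k assume "i \<le> k" "k < n"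
      then have "x k < y k" "x i \<le> x k"
        using xy i strict_mono_on_leD[OF x(1), of i k] by auto
      then show "x i < y k" by linarith
    qed (use i in auto)
    moreover have "poly (right_edge_poly (n + 2)) (x i) = 0"
      using i unfolding p poly_prod by (intro prod_zero) auto
    then have "real (n + 4) * poly ?r (x i)
        = - (real (n + 1) * (1 - 6 * x i + (x i)\<^sup>2) * poly (right_edge_poly (n + 1)) (x i))"
      using poly_right_edge_poly_recurrence[of n "x i"] by simp
    then have "sgn (real (n + 4) * poly ?r (x i))
        = - sgn (real (n + 1) * (1 - 6 * x i + (x i)\<^sup>2) * poly (right_edge_poly (n + 1)) (x i))"
      by (simp only: sgn_minus)
    \<comment> \<open>Negativity of the roots enters here: the recurrence then reverses the sign
      from \<open>n + 1\<close> to \<open>n + 3\<close>.\<close>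
    moreover have "1 - 6 * x i + (x i)\<^sup>2 > 0"
      using x(2) i by (smt (verit) zero_le_power2)
    ultimately show ?thesis
      using i by (simp add: sgn_mult Suc_diff_le)
  qed
  from interlacing_step[OF r x(1) _ this] x(2) obtain z where
    "?r = (\<Prod>i<Suc (Suc n). [:- z i, 1:])" "strict_mono_on {..<Suc (Suc n)} z"
    "\<forall>i<Suc (Suc n). z i < 0" "\<forall>i<Suc n. z i < x i \<and> x i < z (Suc i)"
    by blast
  moreover have "n + 3 = Suc n + 2" "n + 2 = Suc n + 1" by simp_all
  ultimately show ?case using p x by metis
qed

section \<open>Transfer to the Boolean-Narayana polynomials\<close>

lemma nonzero_roots_X_mult_prod:
  assumes "strict_mono_on {..<m} x" "\<And>i. i < m \<Longrightarrow> x i \<noteq> 0"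
  shows "nonzero_roots ([:0, 1:] * (\<Prod>i<m. [:- x i, 1:])) = map x [0..<m]"
proof -
  have "proots (\<Prod>i<m. [:- x i, 1:]) = (\<Sum>i<m. {#x i#})"
    by (subst proots_prod) auto
  also have "\<dots> = mset (map x [0..<m])"
    by (induction m) auto
  finally have roots: "proots (\<Prod>i<m. [:- x i, 1:]) = mset (map x [0..<m])" .
  have "(\<Prod>i<m. [:- x i, 1:]) \<noteq> 0" by (simp del: pCons_one)
  then have "proots ([:0, 1:] * (\<Prod>i<m. [:- x i, 1:])) = {#0#} + mset (map x [0..<m])"
    by (subst proots_mult) (auto simp del: mult_pCons_left simp: roots)
  moreover have "filter_mset (\<lambda>a. a \<noteq> 0) (mset (map x [0..<m])) = mset (map x [0..<m])"
    using assms(2) by (subst filter_mset_eq_conv) auto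
  moreover have "sorted (map x [0..<m])"
    using strict_mono_on_leD[OF assms(1)] by (auto simp: sorted_iff_nth_mono)
  ultimately show ?thesis
    unfolding nonzero_roots_def
    by (simp only: filter_union_mset) (simp add: sort_key_id_if_sorted sorted_sort_id del: mset_map)
qed

lemma real_rooted_X_mult_prod:
  fixes x :: "nat \<Rightarrow> real"
  shows "real_rooted ([:0, 1:] * (\<Prod>i<m. [:- x i, 1:]))"
proof -
  have "poly (map_poly complex_of_real (\<Prod>i<m. [:- x i, 1:])) w = (\<Prod>i<m. w - of_real (x i))" for w
  proof (induction m)
    case (Suc m)
    \<comment> \<open>Multiplicativity is needed only for one linear factor at a time, where
      comparing coefficients suffices.\<close>
    have "map_poly complex_of_real (p * [:a, 1:]) = map_poly of_real p * [:of_real a, 1:]" for p a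
      by (rule poly_eqI) (simp add: coeff_map_poly coeff_pCons split: nat.split)
    then show ?case
      using Suc by (simp only: prod.lessThan_Suc poly_mult) simp
  qed simp
  then show ?thesis
    unfolding real_rooted_def by (auto simp: map_poly_pCons)
qed

theorem theorem5p4:
  fixes n :: nat
  assumes "n \<ge> 2"
  shows "poly (BoNa_poly n) 0 = 0 \<and>
         length (nonzero_roots (BoNa_poly n)) = n - 1 \<and>
         strictly_interlaces (BoNa_poly (n - 1)) (BoNa_poly n)"
proof -
  define k where "k = n - 2"
  have k: "n = k + 2" "n - 1 = k + 1" using assms by (auto simp: k_def)
  obtain x y where p: "right_edge_poly (k + 2) = (\<Prod>i<Suc k. [:- x i, 1:])"
    and q: "right_edge_poly (k + 1) = (\<Prod>i<k. [:- y i, 1:])"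
    and x: "strict_mono_on {..<Suc k} x" "\<forall>i<Suc k. x i < 0"
    and y: "strict_mono_on {..<k} y" "\<forall>i<k. y i < 0"
    and xy: "\<forall>i<k. x i < y i \<and> y i < x (Suc i)"
    using right_edge_poly_interlacing[of k] by blast
  have "nonzero_roots (BoNa_poly n) = map x [0..<Suc k]"
    unfolding BoNa_poly_eq k p using x by (intro nonzero_roots_X_mult_prod) auto
  moreover have "nonzero_roots (BoNa_poly (n - 1)) = map y [0..<k]"
    unfolding BoNa_poly_eq k(2) q using y by (intro nonzero_roots_X_mult_prod) auto
  moreover have "real_rooted (BoNa_poly n)" "real_rooted (BoNa_poly (n - 1))"
    unfolding BoNa_poly_eq k(2) q unfolding k p by (rule real_rooted_X_mult_prod)+
  moreover have "poly (BoNa_poly n) 0 = 0"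
    by (simp add: BoNa_poly_eq)
  ultimately show ?thesis
    using xy k by (simp add: strictly_interlaces_def Let_def nth_append del: upt_Suc)
qed

end
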